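(* Let $\alpha,\beta\geq 0$ be real numbers with $\alpha+\beta\neq 0$, and let $a,b\in\mathbb{R}$ with $a<b$, $b\in\{a+k\alpha: k\in\mathbb{N}_0\}$ and $a\in\{b-k\beta: k\in\mathbb{N}_0\}$. Let $f,g:\mathbb{R}\to\mathbb{R}$. If $f$ and $g$ are $\alpha,\beta$-symmetric integrable on $[a,b]$, then $$\int_{a}^{b}|f(t)g(t)|\,d_{\alpha,\beta}t\leq\sqrt{\left(\int_{a}^{b}|f(t)|^{2}\,d_{\alpha,\beta}t\right)\left(\int_{a}^{b}|g(t)|^{2}\,d_{\alpha,\beta}t\right)}.$$
   Context: $\mathbb{N}_0=\{0,1,2,\dots\}$. Let $h:\mathbb{R}\to\mathbb{R}$ and $a<b$ be reals. For $\alpha>0$, $h$ is $\alpha$-forward integrable on $[a,b]$ if the series $\int_x^{+\infty}h(t)\Delta_\alpha t:=\alpha\sum_{k=0}^{+\infty}h(x+k\alpha)$ converges for $x=a$ and $x=b$; then $\int_a^b h(t)\Delta_\alpha t:=\int_a^{+\infty}h(t)\Delta_\alpha t-\int_b^{+\infty}h(t)\Delta_\alpha t$. For $\beta>0$, $h$ is $\beta$-backward integrable on $[a,b]$ if the series $\int_{-\infty}^x h(t)\nabla_\beta t:=\beta\sum_{k=0}^{+\infty}h(x-k\beta)$ converges for $x=a$ and $x=b$; then $\int_a^b h(t)\nabla_\beta t:=\int_{-\infty}^b h(t)\nabla_\beta t-\int_{-\infty}^a h(t)\nabla_\beta t$. For $\alpha,\beta\ge 0$ with $\alpha+\beta>0$,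 $h$ is $\alpha,\beta$-symmetric integrable on $[a,b]$ if it is $\alpha$-forward integrable and $\beta$-backward integrable on $[a,b]$ (the forward requirement is dropped if $\alpha=0$, and the backward requirement is dropped if $\beta=0$); then $$\int_a^b h(t)\,d_{\alpha,\beta}t:=\frac{\alpha}{\alpha+\beta}\int_a^b h(t)\Delta_\alpha t+\frac{\beta}{\alpha+\beta}\int_a^b h(t)\nabla_\beta t,$$ where a term with zero coefficient is omitted.
   Formalization: The formal theorem also assumes that |f|² and |g|² are α,β-symmetric integrable on [a,b], since integrability of f and g alone does not make the right-hand integrals exist (conditionally convergent series); integrability of |fg| is proved. *)

theory Defs
  imports Complex_Main
begin

definition forward_integrable :: "real \<Rightarrow> (real \<Rightarrow> real) \<Rightarrow> real \<Rightarrow> real \<Rightarrow> bool" where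
  "forward_integrable \<alpha> h a b \<longleftrightarrow>
     summable (\<lambda>k. h (a + real k * \<alpha>)) \<and> summable (\<lambda>k. h (b + real k * \<alpha>))"

definition forward_integral_from :: "real \<Rightarrow> (real \<Rightarrow> real) \<Rightarrow> real \<Rightarrow> real" where
  "forward_integral_from \<alpha> h x = \<alpha> * (\<Sum>k. h (x + real k * \<alpha>))"

definition forward_integral :: "real \<Rightarrow> (real \<Rightarrow> real) \<Rightarrow> real \<Rightarrow> real \<Rightarrow> real" where
  "forward_integral \<alpha> h a b = forward_integral_from \<alpha> h a - forward_integral_from \<alpha> h b"

definition backward_integrable :: "real \<Rightarrow> (real \<Rightarrow> real) \<Rightarrow> real \<Rightarrow> real \<Rightarrow> bool" where
  "backward_integrable \<beta> h a b \<longleftrightarrow>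
     summable (\<lambda>k. h (a - real k * \<beta>)) \<and> summable (\<lambda>k. h (b - real k * \<beta>))"

definition backward_integral_upto :: "real \<Rightarrow> (real \<Rightarrow> real) \<Rightarrow> real \<Rightarrow> real" where
  "backward_integral_upto \<beta> h x = \<beta> * (\<Sum>k. h (x - real k * \<beta>))"

definition backward_integral :: "real \<Rightarrow> (real \<Rightarrow> real) \<Rightarrow> real \<Rightarrow> real \<Rightarrow> real" where
  "backward_integral \<beta> h a b = backward_integral_upto \<beta> h b - backward_integral_upto \<beta> h a"

text \<open>
  The symmetric notions are meant for nonnegative step sizes that are not both zero; a zero
  step size imposes no integrability requirement.
\<close>

definition symmetric_integrable ::
    "real \<Rightarrow> real \<Rightarrow> (real \<Rightarrow> real) \<Rightarrow> real \<Rightarrow> real \<Rightarrow> bool" where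
  "symmetric_integrable \<alpha> \<beta> h a b \<longleftrightarrow>
     (\<alpha> \<noteq> 0 \<longrightarrow> forward_integrable \<alpha> h a b) \<and> (\<beta> \<noteq> 0 \<longrightarrow> backward_integrable \<beta> h a b)"

text \<open>
  A term with zero coefficient vanishes whatever value its integral has, so it needs no case
  distinction. The value is meaningful only for integrands that are symmetric integrable:
  the library sum of a divergent series is an unspecified real number.
\<close>

definition symmetric_integral ::
    "real \<Rightarrow> real \<Rightarrow> (real \<Rightarrow> real) \<Rightarrow> real \<Rightarrow> real \<Rightarrow> real" where
  "symmetric_integral \<alpha> \<beta> h a b =
     \<alpha> / (\<alpha> + \<beta>) * forward_integral \<alpha> h a b + \<beta> / (\<alpha> + \<beta>) * backward_integral \<beta> h a b"

end

theory Submission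
  imports Defs "HOL-Analysis.L2_Norm"
begin

text \<open>
  Since \<open>a\<close> and \<open>b\<close> lie on a common forward grid, the two forward series from \<open>a\<close> and from \<open>b\<close>
  have the same tail, and their difference is a finite sum over the grid points of \<open>[a, b)\<close>;
  likewise the backward integral is a finite sum over grid points of \<open>(a, b]\<close>. The symmetric
  integral is therefore a single finite sum of point values with nonnegative weights, the same
  points and weights for every integrable integrand (\<open>symmetric_integral_eq_weighted_sum\<close>), and
  the inequality is the weighted Cauchy--Schwarz inequality for finite sums. Integrability of
  \<open>\<bar>f g\<bar>\<close> is a separate matter, as it concerns the infinite tails: it comes from
  \<open>\<bar>f g\<bar> \<le> \<bar>f\<bar>\<^sup>2 + \<bar>g\<bar>\<^sup>2\<close> by comparison.
\<close>

lemma abs_mult_le_sum_squares: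
  fixes x y :: real
  shows "\<bar>x * y\<bar> \<le> \<bar>x\<bar>\<^sup>2 + \<bar>y\<bar>\<^sup>2"
proof -
  have "2 * (\<bar>x\<bar> * \<bar>y\<bar>) \<le> \<bar>x\<bar>\<^sup>2 + \<bar>y\<bar>\<^sup>2"
    using sum_squares_bound[of "\<bar>x\<bar>" "\<bar>y\<bar>"] by (simp add: mult.assoc)
  moreover have "0 \<le> \<bar>x\<bar> * \<bar>y\<bar>"
    by simp
  ultimately show ?thesis
    unfolding abs_mult by linarith
qed

lemma summable_abs_mult:
  fixes u v :: "nat \<Rightarrow> real"
  assumes "summable (\<lambda>k. \<bar>u k\<bar>\<^sup>2)" and "summable (\<lambda>k. \<bar>v k\<bar>\<^sup>2)"
  shows "summable (\<lambda>k. \<bar>u k * v k\<bar>)"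
proof (rule summable_comparison_test')
  show "summable (\<lambda>k. \<bar>u k\<bar>\<^sup>2 + \<bar>v k\<bar>\<^sup>2)"
    using assms by (rule summable_add)
  show "norm \<bar>u k * v k\<bar> \<le> \<bar>u k\<bar>\<^sup>2 + \<bar>v k\<bar>\<^sup>2" if "k \<ge> 0" for k
    using abs_mult_le_sum_squares[of "u k" "v k"] by simp
qed

lemma symmetric_integrable_abs_mult:
  assumes "symmetric_integrable \<alpha> \<beta> (\<lambda>t. \<bar>f t\<bar>\<^sup>2) a b"
    and "symmetric_integrable \<alpha> \<beta> (\<lambda>t. \<bar>g t\<bar>\<^sup>2) a b"
  shows "symmetric_integrable \<alpha> \<beta> (\<lambda>t. \<bar>f t * g t\<bar>) a b"
  using assms
  unfolding symmetric_integrable_def forward_integrable_def backward_integrable_def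
  by (auto intro: summable_abs_mult)

lemma forward_integral_eq_sum:
  assumes "forward_integrable \<alpha> h a b" and b: "b = a + real m * \<alpha>"
  shows "forward_integral \<alpha> h a b = (\<Sum>k<m. \<alpha> * h (a + real k * \<alpha>))"
proof -
  have "summable (\<lambda>k. h (a + real k * \<alpha>))"
    using assms(1) by (simp add: forward_integrable_def)
  then have "(\<Sum>k. h (a + real k * \<alpha>)) =
      (\<Sum>k. h (a + real (k + m) * \<alpha>)) + (\<Sum>k<m. h (a + real k * \<alpha>))"
    by (rule suminf_split_initial_segment)
  moreover have "(\<lambda>k. h (a + real (k + m) * \<alpha>)) = (\<lambda>k. h (b + real k * \<alpha>))"
    by (simp add: b algebra_simps)
  ultimately show ?thesis
    by (simp add: forward_integral_def forward_integral_from_def sum_distrib_left algebra_simps)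
qed

text \<open>
  Reflecting the line in \<open>0\<close> exchanges forward and backward integrals.
\<close>

lemma backward_integral_eq_sum:
  assumes "backward_integrable \<beta> h a b" and a: "a = b - real n * \<beta>"
  shows "backward_integral \<beta> h a b = (\<Sum>k<n. \<beta> * h (b - real k * \<beta>))"
proof -
  have "forward_integrable \<beta> (\<lambda>t. h (- t)) (- b) (- a)"
    using assms(1) by (simp add: forward_integrable_def backward_integrable_def)
  from forward_integral_eq_sum[OF this, of n] show ?thesis
    by (simp add: a backward_integral_def backward_integral_upto_def
        forward_integral_def forward_integral_from_def)
qed

text \<open>
  The disjoint sum of the two index ranges keeps the forward and the backward grid points apart:
  the two grids may share points of \<open>[a, b]\<close>, and such a point is counted with both weights.
\<close>

lemma symmetric_integral_eq_weighted_sum: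
  fixes \<alpha> \<beta> a b :: real
  assumes "\<alpha> > 0" and "\<beta> > 0" and "b = a + real m * \<alpha>" and "a = b - real n * \<beta>"
  obtains I :: "(nat + nat) set" and w p :: "nat + nat \<Rightarrow> real"
  where "\<And>i. w i \<ge> 0"
    and "\<And>h. symmetric_integrable \<alpha> \<beta> h a b \<Longrightarrow>
      symmetric_integral \<alpha> \<beta> h a b = (\<Sum>i\<in>I. w i * h (p i))"
proof -
  define w :: "nat + nat \<Rightarrow> real"
    where "w = case_sum (\<lambda>_. \<alpha> / (\<alpha> + \<beta>) * \<alpha>) (\<lambda>_. \<beta> / (\<alpha> + \<beta>) * \<beta>)"
  define p where "p = case_sum (\<lambda>k. a + real k * \<alpha>) (\<lambda>k. b - real k * \<beta>)"
  show thesis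
  proof
    show "w i \<ge> 0" for i
      using assms(1,2) by (cases i) (simp_all add: w_def)
    fix h
    assume "symmetric_integrable \<alpha> \<beta> h a b"
    then have "forward_integral \<alpha> h a b = (\<Sum>k<m. \<alpha> * h (a + real k * \<alpha>))"
      and "backward_integral \<beta> h a b = (\<Sum>k<n. \<beta> * h (b - real k * \<beta>))"
      using assms unfolding symmetric_integrable_def
      by (metis forward_integral_eq_sum less_irrefl,
          metis backward_integral_eq_sum less_irrefl)
    then show "symmetric_integral \<alpha> \<beta> h a b = (\<Sum>i\<in>{..<m} <+> {..<n}. w i * h (p i))"
      by (simp add: symmetric_integral_def sum.Plus w_def p_def sum_distrib_left mult.assoc)
  qed
qed

lemma weighted_Cauchy_Schwarz_sum:
  fixes w u v :: "'i \<Rightarrow> real"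
  assumes "\<And>i. w i \<ge> 0"
  shows "(\<Sum>i\<in>I. w i * \<bar>u i * v i\<bar>)
    \<le> sqrt ((\<Sum>i\<in>I. w i * \<bar>u i\<bar>\<^sup>2) * (\<Sum>i\<in>I. w i * \<bar>v i\<bar>\<^sup>2))"
proof -
  \<comment> \<open>Half of each weight is moved into either factor.\<close>
  have "(\<Sum>i\<in>I. w i * \<bar>u i * v i\<bar>) = (\<Sum>i\<in>I. \<bar>sqrt (w i) * u i\<bar> * \<bar>sqrt (w i) * v i\<bar>)"
  proof (rule sum.cong)
    fix i
    have "w i = sqrt (w i) * sqrt (w i)"
      using assms by simp
    then show "w i * \<bar>u i * v i\<bar> = \<bar>sqrt (w i) * u i\<bar> * \<bar>sqrt (w i) * v i\<bar>"
      using assms by (simp add: abs_mult)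
  qed simp
  also have "\<dots> \<le> L2_set (\<lambda>i. sqrt (w i) * u i) I * L2_set (\<lambda>i. sqrt (w i) * v i) I"
    by (rule L2_set_mult_ineq)
  also have "\<dots> = sqrt ((\<Sum>i\<in>I. w i * \<bar>u i\<bar>\<^sup>2) * (\<Sum>i\<in>I. w i * \<bar>v i\<bar>\<^sup>2))"
    using assms by (simp add: L2_set_def power_mult_distrib real_sqrt_mult)
  finally show ?thesis .
qed

theorem corollary3:
  fixes \<alpha> \<beta> a b :: real and f g :: "real \<Rightarrow> real"
  assumes "\<alpha> \<ge> 0" and "\<beta> \<ge> 0" and "\<alpha> + \<beta> \<noteq> 0"
    and "a < b"
    and "b \<in> {a + real k * \<alpha> |k :: nat. True}"
    and "a \<in> {b - real k * \<beta> |k :: nat. True}"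
    and "symmetric_integrable \<alpha> \<beta> f a b"
    and "symmetric_integrable \<alpha> \<beta> g a b"
    \<comment> \<open>the two integrals on the right-hand side exist\<close>
    and "symmetric_integrable \<alpha> \<beta> (\<lambda>t. \<bar>f t\<bar>\<^sup>2) a b"
    and "symmetric_integrable \<alpha> \<beta> (\<lambda>t. \<bar>g t\<bar>\<^sup>2) a b"
  shows "symmetric_integrable \<alpha> \<beta> (\<lambda>t. \<bar>f t * g t\<bar>) a b \<and>
    symmetric_integral \<alpha> \<beta> (\<lambda>t. \<bar>f t * g t\<bar>) a b
      \<le> sqrt (symmetric_integral \<alpha> \<beta> (\<lambda>t. \<bar>f t\<bar>\<^sup>2) a b *
              symmetric_integral \<alpha> \<beta> (\<lambda>t. \<bar>g t\<bar>\<^sup>2) a b)"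
proof
  show integrable: "symmetric_integrable \<alpha> \<beta> (\<lambda>t. \<bar>f t * g t\<bar>) a b"
    using assms(9,10) by (rule symmetric_integrable_abs_mult)
  obtain m n where b: "b = a + real m * \<alpha>" and a: "a = b - real n * \<beta>"
    using assms(5,6) by blast
  \<comment> \<open>A zero step would force \<open>a = b\<close>.\<close>
  have "\<alpha> \<noteq> 0"
    using b assms(4) by auto
  moreover have "\<beta> \<noteq> 0"
    using a assms(4) by auto
  ultimately have "\<alpha> > 0" and "\<beta> > 0"
    using assms(1,2) by simp_all
  from this b a obtain I :: "(nat + nat) set" and w p :: "nat + nat \<Rightarrow> real"
    where w: "\<And>i. w i \<ge> 0"
      and sum: "\<And>h. symmetric_integrable \<alpha> \<beta> h a b \<Longrightarrow>
        symmetric_integral \<alpha> \<beta> h a b = (\<Sum>i\<in>I. w i * h (p i))"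
    by (rule symmetric_integral_eq_weighted_sum) blast
  show "symmetric_integral \<alpha> \<beta> (\<lambda>t. \<bar>f t * g t\<bar>) a b
      \<le> sqrt (symmetric_integral \<alpha> \<beta> (\<lambda>t. \<bar>f t\<bar>\<^sup>2) a b *
              symmetric_integral \<alpha> \<beta> (\<lambda>t. \<bar>g t\<bar>\<^sup>2) a b)"
    unfolding sum[OF integrable] sum[OF assms(9)] sum[OF assms(10)]
    using w by (rule weighted_Cauchy_Schwarz_sum)
qed

end
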